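(* Let $\Bbbk$ be a field and let $n \ge 16$ be an integer such that $\binom{n}{4}$ is even. For $i \in \{1,2,3,4\}$ let $S_i = \{x_j \mid 1 \le j \le n,\ j \equiv i \pmod 4\}$, with subscripts of $S$ read modulo 4. Define the following sets of squarefree monomials of degree 4 in $\Bbbk[x_1,\dots,x_n]$ (products of four distinct variables): - $G_1 = \{x_t x_u x_v x_w \mid \{x_t,x_u\} \subset S_i,\ x_v \in S_{i+1},\ x_w \in S_{i+2} \text{ for some } i \in \{1,2,3,4\}\}$; - $G_2 = \{x_t x_u x_v x_w \mid \{x_t,x_u\} \subset S_i,\ \{x_v,x_w\} \subset S_j \text{ for some } 1 \le i < j \le 4\}$; - $G_3 = \{x_t x_u x_v x_w \mid \{x_t,x_u,x_v\} \subset S_i,\ x_w \in S_{i-1} \text{ for some } i \in \{1,2,3,4\}\}$; - $G_4 = \{x_t x_u x_v x_w \mid \{x_t,x_u,x_v,x_w\} \subset S_i \text{ for some } i \in \{1,2,3,4\}\}$; - $G_5$: any set of exactly $\frac12\binom{n}{4} - \sum_{i=1}^{4}\#G_i$ squarefree monomials of degree 4 not belonging to $G_1 \cup G_2 \cup G_3 \cup G_4$. Then the ideal $I = \langle G_1 \cup G_2 \cup G_3 \cup G_4 \cup G_5\rangle$ is an $f$-ideal.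
   Context: Let $I \subseteq \Bbbk[x_1,\dots,x_n]$ be a squarefree monomial ideal whose minimal monomial generators all have degree at least 2. Identify a subset $F \subseteq \{x_1,\dots,x_n\}$ with the squarefree monomial $x_F = \prod_{x_i \in F} x_i$. The Stanley-Reisner complex $\Delta_I$ is the simplicial complex whose faces are the sets $F$ with $x_F \notin I$. The facet complex $\Delta(I)$ is the simplicial complex whose facets are the sets $F$ such that $x_F$ is a minimal generator of $I$; that is, its faces are the sets $F$ such that $x_F$ divides some minimal generator of $I$. The $f$-vector of a simplicial complex of dimension $e$ is $(f_{-1},f_0,\dots,f_e)$, where $f_i$ is the number of faces with $i+1$ elements ($f_{-1}=1$ for a nonempty complex). The ideal $I$ is called an $f$-ideal if $\Delta_I$ and $\Delta(I)$ have the same $f$-vector. *)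

theory Defs
  imports "HOL-Library.Poly_Mapping" "HOL-Algebra.Ideal"
begin

text \<open>
  A polynomial is a finitely supported map from exponent vectors to coefficients. The type
  has the variables indexed by all of \<open>nat\<close>; the ring in the variables with
  indices \<open>1, \<dots>, n\<close> is cut out of it as a carrier, so that \<open>n\<close> can vary.
\<close>

type_synonym monom = "nat \<Rightarrow>\<^sub>0 nat"

type_synonym 'k mpoly = "monom \<Rightarrow>\<^sub>0 'k"

definition poly_ring :: "nat \<Rightarrow> 'k::field mpoly ring" where
  "poly_ring n =
    \<lparr>carrier = {p. \<forall>m \<in> Poly_Mapping.keys p. Poly_Mapping.keys m \<subseteq> {1..n}},
     mult = (*), one = 1, zero = 0, add = (+)\<rparr>"

definition X :: "nat \<Rightarrow> 'k::field mpoly" where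
  "X j = Poly_Mapping.single (Poly_Mapping.single j 1) 1"

definition monomials :: "nat \<Rightarrow> 'k::field mpoly set" where
  "monomials n = {Poly_Mapping.single m 1 | m. Poly_Mapping.keys m \<subseteq> {1..n}}"

definition monom_degree :: "monom \<Rightarrow> nat" where
  "monom_degree m = (\<Sum>j \<in> Poly_Mapping.keys m. Poly_Mapping.lookup m j)"

text \<open>
  The squarefree monomial of a set of variables. Throughout, the set of variables
  \<open>{X j | j. j \<in> F}\<close> is represented by its set \<open>F\<close> of indices.
\<close>

definition sqfree_monom :: "nat set \<Rightarrow> 'k::field mpoly" where
  "sqfree_monom F = (\<Prod>j \<in> F. X j)"

definition sqfree_monomials :: "nat \<Rightarrow> 'k::field mpoly set" where
  "sqfree_monomials n = {sqfree_monom F | F. F \<subseteq> {1..n}}"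

definition sqfree_monomial_ideal :: "nat \<Rightarrow> 'k::field mpoly set \<Rightarrow> bool" where
  "sqfree_monomial_ideal n I \<longleftrightarrow>
    (\<exists>A. A \<subseteq> sqfree_monomials n \<and> I = Idl\<^bsub>poly_ring n\<^esub> A)"

text \<open>
  The minimal monomial generators of a monomial ideal are the monomials in it that are minimal
  with respect to divisibility. For monomials in the first \<open>n\<close> variables it makes no
  difference whether divisibility is taken in the type or in the carrier.
\<close>

definition min_gens :: "nat \<Rightarrow> 'k::field mpoly set \<Rightarrow> 'k mpoly set" where
  "min_gens n I =
    {g \<in> I \<inter> monomials n. \<forall>h \<in> I \<inter> monomials n. h dvd g \<longrightarrow> h = g}"

definition stanley_reisner_complex :: "nat \<Rightarrow> 'k::field mpoly set \<Rightarrow> nat set set" where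
  "stanley_reisner_complex n I = {F. F \<subseteq> {1..n} \<and> sqfree_monom F \<notin> I}"

definition facet_complex :: "nat \<Rightarrow> 'k::field mpoly set \<Rightarrow> nat set set" where
  "facet_complex n I = {F. F \<subseteq> {1..n} \<and> (\<exists>g \<in> min_gens n I. sqfree_monom F dvd g)}"

text \<open>
  The \<open>f\<close>-vector as the list $f_{-1}, f_0, \dots, f_e$ of length $e + 2$, where
  $e + 1$ is the largest cardinality of a face: the entry at position \<open>i\<close> counts the faces
  with \<open>i\<close> elements. The void complex has no dimension and gets the empty list.
\<close>

definition f_vector :: "nat set set \<Rightarrow> nat list" where
  "f_vector \<Delta> =
    (if \<Delta> = {} then []
     else map (\<lambda>i. card {F \<in> \<Delta>. card F = i}) [0..<Suc (Max (card ` \<Delta>))])"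

definition f_ideal :: "nat \<Rightarrow> 'k::field mpoly set \<Rightarrow> bool" where
  "f_ideal n I \<longleftrightarrow>
    sqfree_monomial_ideal n I \<and>
    (\<forall>m. Poly_Mapping.single m 1 \<in> min_gens n I \<longrightarrow> 2 \<le> monom_degree m) \<and>
    f_vector (stanley_reisner_complex n I) = f_vector (facet_complex n I)"

text \<open>
  The record above is a ring, so that \<open>Idl\<close> is the ideal generated by a set and not the
  intersection of the empty family.
\<close>

lemma cring_poly_ring: "cring (poly_ring n :: 'k::field mpoly ring)"
proof -
  have add: "Poly_Mapping.keys m \<subseteq> {1..n}"
    if "m \<in> Poly_Mapping.keys (p + q)"
       "\<forall>m \<in> Poly_Mapping.keys p. Poly_Mapping.keys m \<subseteq> {1..n}"
       "\<forall>m \<in> Poly_Mapping.keys q. Poly_Mapping.keys m \<subseteq> {1..n}"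
    for p q :: "'k mpoly" and m
    using that Poly_Mapping.keys_add[of p q] by blast
  have mult: "Poly_Mapping.keys m \<subseteq> {1..n}"
    if m: "m \<in> Poly_Mapping.keys (p * q)"
      and p: "\<forall>m \<in> Poly_Mapping.keys p. Poly_Mapping.keys m \<subseteq> {1..n}"
      and q: "\<forall>m \<in> Poly_Mapping.keys q. Poly_Mapping.keys m \<subseteq> {1..n}"
    for p q :: "'k mpoly" and m
  proof -
    obtain a b where "a \<in> Poly_Mapping.keys p" "b \<in> Poly_Mapping.keys q" "m = a + b"
      using m Poly_Mapping.keys_mult[of p q] by blast
    then show ?thesis using p q Poly_Mapping.keys_add[of a b] by blast
  qed
  show ?thesis
  proof (rule cringI)
    show "abelian_group (poly_ring n :: 'k mpoly ring)"
    proof (rule abelian_groupI)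
      fix p :: "'k mpoly"
      assume "p \<in> carrier (poly_ring n)"
      then show "\<exists>q \<in> carrier (poly_ring n). q \<oplus>\<^bsub>poly_ring n\<^esub> p = \<zero>\<^bsub>poly_ring n\<^esub>"
        by (intro bexI[of _ "- p"]) (auto simp: poly_ring_def)
    qed (use add in \<open>auto simp: poly_ring_def algebra_simps\<close>)
    show "Group.comm_monoid (poly_ring n :: 'k mpoly ring)"
      by (rule comm_monoidI) (use mult in \<open>auto simp: poly_ring_def algebra_simps\<close>)
  qed (auto simp: poly_ring_def algebra_simps)
qed

end

theory Submission
  imports Defs
begin

text \<open>
  All generators have degree 4, so the ideal is described by the family \<open>\<F>\<close> of the 4-sets of
  indices of its generators, and the two complexes become combinatorial objects: a set is a face of
  the Stanley-Reisner complex if it contains no member of \<open>\<F>\<close>, and a face of the facet complex if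
  it lies inside a member. This translation rests on the membership criterion for monomial ideals
  (\<open>single_in_genideal_iff\<close>): a monomial lies in the ideal generated by a set of monomials only
  if one of them divides it.

  For a family of \<open>d\<close>-sets the two \<open>f\<close>-vectors are then compared entry by entry
  (\<open>f_ideal_uniform\<close>). Below size \<open>d\<close> every set is a face of the Stanley-Reisner complex, so
  the facet complex has to contain all of them, for which it is enough that every \<open>(d - 1)\<close>-set
  lies in a member. Above size \<open>d\<close> the facet complex has no faces, so every
  \<open>(d + 1)\<close>-set has to contain a member. In size \<open>d\<close> the faces are the members on one side and
  the non-members on the other, so there must be as many members as non-members. The set of
  additional generators makes the last condition true by the choice of its cardinality, once the four
  prescribed types of generators are known to be pairwise disjoint.

  The other two conditions hold already for the four prescribed types, and only the distribution of
  a set among the four residue classes modulo 4 matters. Five indices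
  (\<open>five_indices_contain_member\<close>) have two in a common class. If no other class
  contains two and no class contains four, then the remaining elements lie in different classes, and
  they include either one from each of the next two classes, or one from the previous class while
  the crowded class has three. Three indices (\<open>three_indices_in_member\<close>) are completed to a
  member by a new element of the class of a suitable one of them, which exists since \<open>n \<ge> 16\<close>
  gives each class four elements.
\<close>

section \<open>Divisibility of monomials and monomial ideals\<close>

definition exponent_of :: "nat set \<Rightarrow> monom" where
  "exponent_of F = (\<Sum>j\<in>F. Poly_Mapping.single j 1)"

lemma lookup_exponent_of:
  assumes "finite F"
  shows "Poly_Mapping.lookup (exponent_of F) j = (if j \<in> F then 1 else 0)"
  using assms
  by (induction F rule: finite_induct) (auto simp: exponent_of_def lookup_add lookup_single when_def)

lemma keys_exponent_of: "finite F \<Longrightarrow> Poly_Mapping.keys (exponent_of F) = F"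
  by (auto simp: in_keys_iff lookup_exponent_of split: if_splits)

lemma monom_degree_exponent_of: "finite F \<Longrightarrow> monom_degree (exponent_of F) = card F"
  by (simp add: monom_degree_def keys_exponent_of lookup_exponent_of)

lemma sqfree_monom_eq_single:
  "(sqfree_monom F :: 'k::field mpoly) = Poly_Mapping.single (exponent_of F) 1"
  by (induction F rule: infinite_finite_induct)
    (simp_all add: sqfree_monom_def exponent_of_def X_def mult_single)

lemma single_one_eq_iff:
  "(Poly_Mapping.single a 1 :: 'k::field mpoly) = Poly_Mapping.single b 1 \<longleftrightarrow> a = b"
  by (metis keys_single singleton_insert_inj_eq zero_neq_one)

lemma sqfree_monom_eq_iff:
  assumes "finite F" "finite G"
  shows "(sqfree_monom F :: 'k::field mpoly) = sqfree_monom G \<longleftrightarrow> F = G"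
  using assms by (metis sqfree_monom_eq_single single_one_eq_iff keys_exponent_of)

lemma single_dvd_single_iff:
  "(Poly_Mapping.single a 1 :: 'k::field mpoly) dvd Poly_Mapping.single e 1 \<longleftrightarrow> (\<exists>b. e = a + b)"
proof
  assume "(Poly_Mapping.single a 1 :: 'k mpoly) dvd Poly_Mapping.single e 1"
  then obtain q :: "'k mpoly" where q: "Poly_Mapping.single e 1 = Poly_Mapping.single a 1 * q"
    by (elim dvdE)
  have "e \<in> Poly_Mapping.keys (Poly_Mapping.single a 1 * q)"
    unfolding q[symmetric] by simp
  then show "\<exists>b. e = a + b"
    using Poly_Mapping.keys_mult[of "Poly_Mapping.single a 1" q] by auto
next
  assume "\<exists>b. e = a + b"
  then obtain b where "e = a + b" ..
  then have "(Poly_Mapping.single e 1 :: 'k mpoly) = Poly_Mapping.single a 1 * Poly_Mapping.single b 1"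
    by (simp add: mult_single)
  then show "(Poly_Mapping.single a 1 :: 'k mpoly) dvd Poly_Mapping.single e 1"
    by simp
qed

text \<open>
  Exponents of a squarefree monomial are at most 1, so it divides a monomial as soon as the support
  of the former lies in the support of the latter.
\<close>

lemma exponent_of_add_iff:
  assumes "finite F"
  shows "(\<exists>b. e = exponent_of F + b) \<longleftrightarrow> F \<subseteq> Poly_Mapping.keys e"
proof
  assume "\<exists>b. e = exponent_of F + b"
  then show "F \<subseteq> Poly_Mapping.keys e"
    using assms by (auto simp: in_keys_iff lookup_add lookup_exponent_of)
next
  assume F: "F \<subseteq> Poly_Mapping.keys e"
  have "Poly_Mapping.lookup e j =
      Poly_Mapping.lookup (exponent_of F) j + Poly_Mapping.lookup (e - exponent_of F) j" for j
    using F assms by (auto simp: lookup_minus lookup_exponent_of in_keys_iff)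
  then have "e = exponent_of F + (e - exponent_of F)"
    by (intro poly_mapping_eqI) (simp add: lookup_add)
  then show "\<exists>b. e = exponent_of F + b" ..
qed

text \<open>
  The polynomials all of whose monomials are multiples of generators form an ideal,
  and this ideal contains the generators; a monomial in the generated ideal is therefore such a
  multiple.
\<close>

lemma single_in_genideal_iff:
  fixes n :: nat and M :: "monom set"
  assumes M: "\<And>a. a \<in> M \<Longrightarrow> Poly_Mapping.keys a \<subseteq> {1..n}"
    and e: "Poly_Mapping.keys e \<subseteq> {1..n}"
  shows "(Poly_Mapping.single e 1 :: 'k::field mpoly) \<in>
           Idl\<^bsub>poly_ring n\<^esub> ((\<lambda>a. Poly_Mapping.single a 1) ` M) \<longleftrightarrow> (\<exists>a\<in>M. \<exists>b. e = a + b)"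
proof -
  let ?R = "poly_ring n :: 'k mpoly ring"
  let ?A = "(\<lambda>a. Poly_Mapping.single a 1) ` M :: 'k mpoly set"
  interpret R: cring ?R by (rule cring_poly_ring)
  have A: "?A \<subseteq> carrier ?R" using M by (fastforce simp: poly_ring_def)
  \<comment> \<open>the span of the monomials divisible by a generator\<close>
  define J :: "'k mpoly set" where
    "J = {p \<in> carrier ?R. \<forall>m \<in> Poly_Mapping.keys p. \<exists>a\<in>M. \<exists>b. m = a + b}"
  have multiple: "x * p \<in> J" if p: "p \<in> J" and x: "x \<in> carrier ?R" for p x
  proof -
    have "x * p \<in> carrier ?R"
      using R.m_closed[OF x, of p] p by (simp add: J_def poly_ring_def)
    moreover have "\<exists>a\<in>M. \<exists>b. m = a + b" if m: "m \<in> Poly_Mapping.keys (x * p)" for m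
    proof -
      obtain c d where cd: "d \<in> Poly_Mapping.keys p" "m = c + d"
        using m Poly_Mapping.keys_mult[of x p] by blast
      then obtain a b where "a \<in> M" "d = a + b" using p unfolding J_def by blast
      then have "m = a + (c + b)" using cd by (simp add: algebra_simps)
      then show ?thesis using \<open>a \<in> M\<close> by blast
    qed
    ultimately show ?thesis unfolding J_def by blast
  qed
  have "ideal J ?R"
  proof (rule idealI)
    show "ring ?R" by (rule R.ring_axioms)
    show "subgroup J (add_monoid ?R)"
    proof (rule group.subgroupI)
      show "Group.group (add_monoid ?R)" by (rule R.a_group)
      show "J \<subseteq> carrier (add_monoid ?R)" by (auto simp: J_def)
      have "0 \<in> J" by (auto simp: J_def poly_ring_def)
      then show "J \<noteq> {}" by blast
      fix p assume p: "p \<in> J"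
      have "- p \<in> J" using p by (auto simp: J_def poly_ring_def)
      moreover have "inv\<^bsub>add_monoid ?R\<^esub> p = - p"
        using p by (intro group.inv_equality[OF R.a_group]) (auto simp: J_def poly_ring_def)
      ultimately show "inv\<^bsub>add_monoid ?R\<^esub> p \<in> J" by simp
      fix q assume q: "q \<in> J"
      have "p + q \<in> carrier ?R"
        using p q R.a_closed[of p q] by (simp add: J_def poly_ring_def)
      then have "p + q \<in> J"
        using p q Poly_Mapping.keys_add[of p q] unfolding J_def by blast
      then show "p \<otimes>\<^bsub>add_monoid ?R\<^esub> q \<in> J" by (simp add: poly_ring_def)
    qed
    fix p x assume "p \<in> J" and "x \<in> carrier ?R"
    then have "x * p \<in> J" by (rule multiple)
    then show "x \<otimes>\<^bsub>?R\<^esub> p \<in> J" "p \<otimes>\<^bsub>?R\<^esub> x \<in> J"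
      by (simp_all add: poly_ring_def mult.commute)
  qed
  moreover have "?A \<subseteq> J"
  proof
    fix p assume "p \<in> ?A"
    then obtain a where "a \<in> M" "p = Poly_Mapping.single a 1" by blast
    moreover have "\<exists>a'\<in>M. \<exists>b. a = a' + b" if "a \<in> M"
      using that by (intro bexI[of _ a] exI[of _ 0]) simp_all
    ultimately show "p \<in> J" using A \<open>p \<in> ?A\<close> by (auto simp: J_def)
  qed
  ultimately have "Idl\<^bsub>?R\<^esub> ?A \<subseteq> J" by (rule R.genideal_minimal)
  then have "\<exists>a\<in>M. \<exists>b. e = a + b" if "(Poly_Mapping.single e 1 :: 'k mpoly) \<in> Idl\<^bsub>?R\<^esub> ?A"
    using that unfolding J_def by auto
  moreover have "(Poly_Mapping.single e 1 :: 'k mpoly) \<in> Idl\<^bsub>?R\<^esub> ?A"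
    if a: "a \<in> M" and eq: "e = a + b" for a b
  proof -
    have "Poly_Mapping.keys b \<subseteq> Poly_Mapping.keys e"
      by (auto simp: eq in_keys_iff lookup_add)
    then have "Poly_Mapping.single b 1 \<in> carrier ?R"
      using e by (auto simp: poly_ring_def)
    moreover have "Poly_Mapping.single a 1 \<in> Idl\<^bsub>?R\<^esub> ?A"
      using R.genideal_self[OF A] a by blast
    ultimately have "Poly_Mapping.single a 1 \<otimes>\<^bsub>?R\<^esub> Poly_Mapping.single b 1 \<in> Idl\<^bsub>?R\<^esub> ?A"
      by (intro ideal.I_r_closed[OF R.genideal_ideal[OF A]])
    then show ?thesis by (simp add: poly_ring_def mult_single eq)
  qed
  ultimately show ?thesis by blast
qed

lemma single_in_sqfree_ideal_iff:
  assumes "\<And>F. F \<in> \<F> \<Longrightarrow> F \<subseteq> {1..n}" and "Poly_Mapping.keys e \<subseteq> {1..n}"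
  shows "(Poly_Mapping.single e 1 :: 'k::field mpoly) \<in> Idl\<^bsub>poly_ring n\<^esub> (sqfree_monom ` \<F>) \<longleftrightarrow>
    (\<exists>F\<in>\<F>. F \<subseteq> Poly_Mapping.keys e)"
proof -
  have fin: "finite F" if "F \<in> \<F>" for F
    using assms(1)[OF that] finite_subset by blast
  have "(sqfree_monom ` \<F> :: 'k mpoly set) =
      (\<lambda>a. Poly_Mapping.single a 1) ` exponent_of ` \<F>"
    by (auto simp: sqfree_monom_eq_single)
  moreover have "(Poly_Mapping.single e 1 :: 'k mpoly) \<in>
      Idl\<^bsub>poly_ring n\<^esub> ((\<lambda>a. Poly_Mapping.single a 1) ` exponent_of ` \<F>) \<longleftrightarrow>
      (\<exists>a\<in>exponent_of ` \<F>. \<exists>b. e = a + b)"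
  proof (rule single_in_genideal_iff[OF _ assms(2)])
    fix a assume "a \<in> exponent_of ` \<F>"
    then show "Poly_Mapping.keys a \<subseteq> {1..n}"
      using assms(1) fin keys_exponent_of by blast
  qed
  ultimately show ?thesis using exponent_of_add_iff[OF fin] by auto
qed

section \<open>The two complexes of a squarefree monomial ideal\<close>

text \<open>
  A minimal monomial of the ideal is divisible by a generator, hence equal to it. Conversely, a
  monomial of the ideal that divides a generator is a multiple of a second generator; since the family is an
  antichain, both generators agree, and divisibility in both directions leaves only equality.
\<close>

lemma min_gens_sqfree_ideal:
  assumes sub: "\<And>F. F \<in> \<F> \<Longrightarrow> F \<subseteq> {1..n}"
    and antichain: "\<And>F G. F \<in> \<F> \<Longrightarrow> G \<in> \<F> \<Longrightarrow> F \<subseteq> G \<Longrightarrow> F = G"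
  shows "min_gens n (Idl\<^bsub>poly_ring n\<^esub> (sqfree_monom ` \<F>) :: 'k::field mpoly set) = sqfree_monom ` \<F>"
    (is "min_gens n ?I = _")
proof (intro equalityI subsetI)
  have fin: "finite F" if "F \<in> \<F>" for F
    using sub[OF that] finite_subset by blast
  have gen: "(sqfree_monom F :: 'k mpoly) \<in> ?I \<inter> monomials n" if "F \<in> \<F>" for F
  proof -
    have keys: "Poly_Mapping.keys (exponent_of F) = F" using fin[OF that] by (rule keys_exponent_of)
    then have "(sqfree_monom F :: 'k mpoly) \<in> ?I"
      using single_in_sqfree_ideal_iff[of \<F> n "exponent_of F"] that sub
      unfolding sqfree_monom_eq_single[of F] by auto
    moreover have "(sqfree_monom F :: 'k mpoly) \<in> monomials n"
      using keys sub[OF that] unfolding sqfree_monom_eq_single monomials_def by blast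
    ultimately show ?thesis ..
  qed
  show "g \<in> sqfree_monom ` \<F>" if g: "g \<in> min_gens n ?I" for g
  proof -
    obtain e where e: "g = Poly_Mapping.single e 1" "Poly_Mapping.keys e \<subseteq> {1..n}"
      using g by (auto simp: min_gens_def monomials_def)
    then obtain F where F: "F \<in> \<F>" "F \<subseteq> Poly_Mapping.keys e"
      using g single_in_sqfree_ideal_iff[of \<F> n e] sub by (auto simp: min_gens_def)
    then have "sqfree_monom F dvd g"
      using e exponent_of_add_iff[OF fin, of F e] by (simp add: sqfree_monom_eq_single single_dvd_single_iff)
    then have "sqfree_monom F = g"
      using g gen[OF F(1)] by (auto simp: min_gens_def)
    then show ?thesis using F by blast
  qed
  show "g \<in> min_gens n ?I" if g: "g \<in> sqfree_monom ` \<F>" for g :: "'k mpoly"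
  proof -
    obtain F where F: "F \<in> \<F>" "g = sqfree_monom F" using g by blast
    have "h = g" if h: "h \<in> ?I" "h \<in> monomials n" "h dvd g" for h
    proof -
      obtain e where e: "h = Poly_Mapping.single e 1" "Poly_Mapping.keys e \<subseteq> {1..n}"
        using h(2) by (auto simp: monomials_def)
      then obtain G where G: "G \<in> \<F>" "G \<subseteq> Poly_Mapping.keys e"
        using h(1) single_in_sqfree_ideal_iff[of \<F> n e] sub by auto
      obtain b where b: "exponent_of F = e + b"
        using h(3) by (auto simp: e F sqfree_monom_eq_single single_dvd_single_iff)
      have le: "Poly_Mapping.lookup e j \<le> (if j \<in> F then 1 else 0)" for j
        using lookup_exponent_of[OF fin[OF F(1)], of j] unfolding b by (simp add: lookup_add)
      then have "Poly_Mapping.keys e \<subseteq> F"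
        by (metis in_keys_iff le_zero_eq subsetI)
      then have keys: "Poly_Mapping.keys e = F" using antichain[OF G(1) F(1)] G(2) by auto
      have "Poly_Mapping.lookup e j = (if j \<in> F then 1 else 0)" for j
        using le[of j] keys by (auto simp: in_keys_iff split: if_splits)
      then have "e = exponent_of F"
        by (intro poly_mapping_eqI) (simp add: lookup_exponent_of fin F(1))
      then show ?thesis by (simp add: e F sqfree_monom_eq_single)
    qed
    then show ?thesis using gen[OF F(1)] unfolding F(2) min_gens_def by blast
  qed
qed

lemma stanley_reisner_sqfree_ideal:
  assumes "\<And>F. F \<in> \<F> \<Longrightarrow> F \<subseteq> {1..n}"
  shows "stanley_reisner_complex n (Idl\<^bsub>poly_ring n\<^esub> (sqfree_monom ` \<F>) :: 'k::field mpoly set) =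
    {F. F \<subseteq> {1..n} \<and> (\<forall>G\<in>\<F>. \<not> G \<subseteq> F)}"
proof -
  have "(sqfree_monom F :: 'k mpoly) \<in> Idl\<^bsub>poly_ring n\<^esub> (sqfree_monom ` \<F>) \<longleftrightarrow> (\<exists>G\<in>\<F>. G \<subseteq> F)"
    if "F \<subseteq> {1..n}" for F
    using that single_in_sqfree_ideal_iff[of \<F> n "exponent_of F"] assms keys_exponent_of[of F]
      finite_subset[OF that]
    by (simp add: sqfree_monom_eq_single)
  then show ?thesis unfolding stanley_reisner_complex_def by blast
qed

lemma facet_complex_sqfree_ideal:
  assumes sub: "\<And>F. F \<in> \<F> \<Longrightarrow> F \<subseteq> {1..n}"
    and antichain: "\<And>F G. F \<in> \<F> \<Longrightarrow> G \<in> \<F> \<Longrightarrow> F \<subseteq> G \<Longrightarrow> F = G"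
  shows "facet_complex n (Idl\<^bsub>poly_ring n\<^esub> (sqfree_monom ` \<F>) :: 'k::field mpoly set) =
    {F. F \<subseteq> {1..n} \<and> (\<exists>G\<in>\<F>. F \<subseteq> G)}"
proof -
  have "(sqfree_monom F :: 'k mpoly) dvd sqfree_monom G \<longleftrightarrow> F \<subseteq> G"
    if "F \<subseteq> {1..n}" "G \<in> \<F>" for F G
    using finite_subset[OF that(1)] finite_subset[OF sub[OF that(2)]]
      exponent_of_add_iff[of F "exponent_of G"]
    by (simp add: sqfree_monom_eq_single single_dvd_single_iff keys_exponent_of)
  moreover have "min_gens n (Idl\<^bsub>poly_ring n\<^esub> (sqfree_monom ` \<F>) :: 'k mpoly set) = sqfree_monom ` \<F>"
    by (rule min_gens_sqfree_ideal) (use assms in blast)+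
  ultimately show ?thesis by (auto simp: facet_complex_def)
qed

section \<open>A criterion for ideals generated in one degree\<close>

text \<open>
  The two lists have the same length, because the largest cardinality of a face is the last position
  at which the face count is nonzero.
\<close>

lemma f_vector_eqI:
  assumes "finite \<Delta>" "finite \<Gamma>" and "\<Delta> \<noteq> {}" "\<Gamma> \<noteq> {}"
    and eq: "\<And>i. card {F\<in>\<Delta>. card F = i} = card {F\<in>\<Gamma>. card F = i}"
  shows "f_vector \<Delta> = f_vector \<Gamma>"
proof -
  have "i \<in> card ` \<Delta> \<longleftrightarrow> i \<in> card ` \<Gamma>" for i
  proof -
    have "i \<in> card ` \<Theta> \<longleftrightarrow> card {F\<in>\<Theta>. card F = i} \<noteq> 0" if "finite \<Theta>" for \<Theta> :: "nat set set"
      using that by (auto simp: card_eq_0_iff)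
    from this[OF assms(1)] this[OF assms(2)] eq[of i] show ?thesis by (simp only:)
  qed
  then have "card ` \<Delta> = card ` \<Gamma>" by blast
  then show ?thesis using assms by (simp add: f_vector_def)
qed

text \<open>
  The hypotheses \<open>lower\<close>, \<open>half\<close> and \<open>upper\<close> yield equality of the face counts in sizes
  below \<open>d\<close>, equal to \<open>d\<close> and above \<open>d\<close>, respectively. Members of \<open>\<F>\<close> have the same
  size and so form an antichain, which makes them the facets of the facet complex.
\<close>

lemma f_ideal_uniform:
  fixes \<F> :: "nat set set" and n d :: nat
  assumes d: "2 \<le> d" "d \<le> n"
    and sub: "\<And>F. F \<in> \<F> \<Longrightarrow> F \<subseteq> {1..n} \<and> card F = d"
    and half: "2 * card \<F> = n choose d"
    and lower: "\<And>F. F \<subseteq> {1..n} \<Longrightarrow> card F = d - 1 \<Longrightarrow> \<exists>G\<in>\<F>. F \<subseteq> G"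
    and upper: "\<And>F. F \<subseteq> {1..n} \<Longrightarrow> card F = d + 1 \<Longrightarrow> \<exists>G\<in>\<F>. G \<subseteq> F"
  shows "f_ideal n (Idl\<^bsub>poly_ring n\<^esub> (sqfree_monom ` \<F>) :: 'k::field mpoly set)"
proof -
  let ?I = "Idl\<^bsub>poly_ring n\<^esub> (sqfree_monom ` \<F>) :: 'k mpoly set"
  have fin: "finite F" if "F \<subseteq> {1..n}" for F using that finite_subset by blast
  have antichain: "F = G" if "F \<in> \<F>" "G \<in> \<F>" "F \<subseteq> G" for F G
    using that sub fin by (metis card_subset_eq)
  have "finite \<F>" by (rule finite_subset[of _ "Pow {1..n}"]) (use sub in auto)
  have gens: "min_gens n ?I = sqfree_monom ` \<F>"
    using sub antichain by (intro min_gens_sqfree_ideal) auto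
  define \<Delta> where "\<Delta> = {F. F \<subseteq> {1..n} \<and> (\<forall>G\<in>\<F>. \<not> G \<subseteq> F)}"
  define \<Gamma> where "\<Gamma> = {F. F \<subseteq> {1..n} \<and> (\<exists>G\<in>\<F>. F \<subseteq> G)}"
  have SR: "stanley_reisner_complex n ?I = \<Delta>"
    unfolding \<Delta>_def using sub by (intro stanley_reisner_sqfree_ideal) auto
  have facet: "facet_complex n ?I = \<Gamma>"
    unfolding \<Gamma>_def using sub antichain by (intro facet_complex_sqfree_ideal) auto
  have "n choose d > 0" using d by simp
  then have "\<F> \<noteq> {}" using half by auto
  have nonempty: "G \<noteq> {}" if "G \<in> \<F>" for G using sub[OF that] d(1) by auto
  have "card {F\<in>\<Delta>. card F = i} = card {F\<in>\<Gamma>. card F = i}" for i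
  proof -
    consider "i < d" | "i = d" | "i > d" by linarith
    then show ?thesis
    proof cases
      case 1
      have "F \<in> \<Delta> \<and> F \<in> \<Gamma>" if F: "F \<subseteq> {1..n}" "card F = i" for F
      proof
        show "F \<in> \<Delta>"
        proof -
          have "\<not> G \<subseteq> F" if "G \<in> \<F>" for G
            using sub[OF that] F(2) 1 card_mono[OF fin[OF F(1)], of G] by auto
          then show ?thesis using F(1) by (simp add: \<Delta>_def)
        qed
        have "\<exists>H. F \<subseteq> H \<and> H \<subseteq> {1..n} \<and> card H = d - 1"
          by (rule exists_subset_between) (use F 1 d in auto)
        then obtain H where H: "F \<subseteq> H" "H \<subseteq> {1..n}" "card H = d - 1" by (elim exE conjE)
        obtain G where G: "G \<in> \<F>" "H \<subseteq> G" using lower[OF H(2,3)] by (elim bexE)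
        have "F \<subseteq> G" using H(1) G(2) by (rule subset_trans)
        then show "F \<in> \<Gamma>"
          unfolding \<Gamma>_def using F(1) G(1) by (intro CollectI conjI bexI[of _ G])
      qed
      then have "{F\<in>\<Delta>. card F = i} = {F\<in>\<Gamma>. card F = i}"
        by (auto simp: \<Delta>_def \<Gamma>_def)
      then show ?thesis by simp
    next
      case 2
      have "{F\<in>\<Gamma>. card F = i} = \<F>"
      proof (intro equalityI subsetI)
        fix F assume "F \<in> {F\<in>\<Gamma>. card F = i}"
        then obtain G where "G \<in> \<F>" "F \<subseteq> G" "card F = d" using 2 by (auto simp: \<Gamma>_def)
        then show "F \<in> \<F>" using sub[of G] fin[of G] card_subset_eq[of G F] by simp
      qed (use sub 2 in \<open>auto simp: \<Gamma>_def\<close>)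
      moreover have "{F\<in>\<Delta>. card F = i} = {F. F \<subseteq> {1..n} \<and> card F = d} - \<F>"
      proof (intro equalityI subsetI)
        fix F assume F: "F \<in> {F. F \<subseteq> {1..n} \<and> card F = d} - \<F>"
        have "\<not> G \<subseteq> F" if "G \<in> \<F>" for G
          using F sub[OF that] that fin[of F] card_subset_eq[of F G] by auto
        then show "F \<in> {F\<in>\<Delta>. card F = i}" using F 2 by (auto simp: \<Delta>_def)
      qed (use 2 in \<open>auto simp: \<Delta>_def\<close>)
      moreover have "card ({F. F \<subseteq> {1..n} \<and> card F = d} - \<F>) = (n choose d) - card \<F>"
        using sub \<open>finite \<F>\<close> n_subsets[of "{1..n}" d] by (subst card_Diff_subset) auto
      ultimately show ?thesis using half by simp
    next
      case 3
      have "F \<notin> \<Gamma>" if F: "card F = i" for F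
      proof
        assume "F \<in> \<Gamma>"
        then obtain G where "G \<in> \<F>" "F \<subseteq> G" by (auto simp: \<Gamma>_def)
        then show False using F 3 sub[of G] fin[of G] card_mono[of G F] by simp
      qed
      moreover have "F \<notin> \<Delta>" if F: "card F = i" for F
      proof
        assume "F \<in> \<Delta>"
        then have no_gen: "F \<subseteq> {1..n}" "\<And>G. G \<in> \<F> \<Longrightarrow> \<not> G \<subseteq> F" by (auto simp: \<Delta>_def)
        have "d + 1 \<le> card F" using F 3 by simp
        then obtain H where H: "H \<subseteq> F" "card H = d + 1" by (rule obtain_subset_with_card_n)
        obtain G where G: "G \<in> \<F>" "G \<subseteq> H"
          using upper[OF subset_trans[OF H(1) no_gen(1)] H(2)] by (elim bexE)
        show False using no_gen(2)[OF G(1)] subset_trans[OF G(2) H(1)] by (rule notE)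
      qed
      ultimately have "{F\<in>\<Delta>. card F = i} = {}" "{F\<in>\<Gamma>. card F = i} = {}" by blast+
      then show ?thesis by (simp only:)
    qed
  qed
  moreover have "finite \<Delta>" "finite \<Gamma>" by (auto simp: \<Delta>_def \<Gamma>_def)
  moreover have "{} \<in> \<Delta>" "{} \<in> \<Gamma>"
    using \<open>\<F> \<noteq> {}\<close> nonempty by (auto simp: \<Delta>_def \<Gamma>_def)
  ultimately have fv: "f_vector \<Delta> = f_vector \<Gamma>" by (intro f_vector_eqI) auto
  have degree: "2 \<le> monom_degree m" if m: "Poly_Mapping.single m 1 \<in> min_gens n ?I" for m
  proof -
    obtain F where "F \<in> \<F>" "(Poly_Mapping.single m 1 :: 'k mpoly) = sqfree_monom F"
      using m unfolding gens by blast
    then have "m = exponent_of F" "card F = d" "finite F"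
      using sub fin by (auto simp: sqfree_monom_eq_single single_one_eq_iff)
    then show ?thesis using d by (simp add: monom_degree_exponent_of)
  qed
  have "sqfree_monomial_ideal n ?I"
    unfolding sqfree_monomial_ideal_def sqfree_monomials_def
    by (rule exI[of _ "sqfree_monom ` \<F>"]) (use sub in auto)
  then show ?thesis
    unfolding f_ideal_def SR facet using degree fv by (intro conjI allI impI)
qed

section \<open>Families of four indices with prescribed residues\<close>

text \<open>
  Residue classes modulo 4, arranged in a cycle. The case distinctions on five and on three indices
  use of them only that \<open>i\<close>, \<open>i + 1\<close>, \<open>i + 2\<close> and \<open>i + 3\<close> represent the four classes and that the
  class of \<open>i + k\<close> depends on the class of \<open>i\<close> alone.
\<close>

definition residue :: "nat \<Rightarrow> nat" where
  "residue x = x mod 4"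

lemma shifted_residues_distinct:
  "residue (i + 1) \<noteq> residue i" "residue (i + 2) \<noteq> residue i" "residue (i + 3) \<noteq> residue i"
  "residue (i + 2) \<noteq> residue (i + 1)" "residue (i + 3) \<noteq> residue (i + 1)"
  "residue (i + 3) \<noteq> residue (i + 2)"
  unfolding residue_def by presburger+

lemma shifted_residues_cover:
  "residue x = residue i \<or> residue x = residue (i + 1) \<or> residue x = residue (i + 2) \<or>
   residue x = residue (i + 3)"
proof -
  \<comment> \<open>\<open>3 * i\<close> represents \<open>- i\<close> modulo 4, so \<open>k\<close> is the residue of \<open>x - i\<close>\<close>
  define k where "k = (x + 3 * i) mod 4"
  have "x mod 4 = (x + 4 * i) mod 4" by simp
  also have "\<dots> = (i + (x + 3 * i)) mod 4" by (rule arg_cong[of _ _ "\<lambda>m. m mod 4"]) simp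
  also have "\<dots> = (i + k) mod 4" unfolding k_def by (rule mod_add_right_eq[symmetric])
  finally have eq: "residue x = residue (i + k)" unfolding residue_def .
  have "k < 4" by (simp add: k_def)
  then consider "k = 0" | "k = 1" | "k = 2" | "k = 3" by linarith
  then show ?thesis using eq by cases simp_all
qed

lemma shifted_residue_cong:
  "residue a = residue i \<Longrightarrow> residue (a + k) = residue (i + k)"
  unfolding residue_def by (metis mod_add_left_eq)

text \<open>
  The index sets of the prescribed generators, sorted by the numbers of elements that they have in
  the classes: \<open>2 + 1 + 1\<close>, \<open>2 + 2\<close>, \<open>3 + 1\<close> and \<open>4\<close>. The first and the third
  type also restrict the position of the classes on the cycle.
\<close>

definition pair_and_next_two :: "nat \<Rightarrow> nat set set" where
  "pair_and_next_two n = {{a, b, c, d} | a b c d. {a, b, c, d} \<subseteq> {1..n} \<and> distinct [a, b, c, d] \<and>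
     residue b = residue a \<and> residue c = residue (a + 1) \<and> residue d = residue (a + 2)}"

definition two_pairs :: "nat \<Rightarrow> nat set set" where
  "two_pairs n = {{a, b, c, d} | a b c d. {a, b, c, d} \<subseteq> {1..n} \<and> distinct [a, b, c, d] \<and>
     residue b = residue a \<and> residue c \<noteq> residue a \<and> residue d = residue c}"

definition triple_and_previous :: "nat \<Rightarrow> nat set set" where
  "triple_and_previous n = {{a, b, c, d} | a b c d. {a, b, c, d} \<subseteq> {1..n} \<and> distinct [a, b, c, d] \<and>
     residue b = residue a \<and> residue c = residue a \<and> residue d = residue (a + 3)}"

definition quadruple :: "nat \<Rightarrow> nat set set" where
  "quadruple n = {{a, b, c, d} | a b c d. {a, b, c, d} \<subseteq> {1..n} \<and> distinct [a, b, c, d] \<and>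
     residue b = residue a \<and> residue c = residue a \<and> residue d = residue a}"

lemma pair_and_next_twoI:
  assumes "{a, b, c, d} \<subseteq> {1..n}" "distinct [a, b, c, d]"
    and "residue b = residue a" "residue c = residue (a + 1)" "residue d = residue (a + 2)"
  shows "{a, b, c, d} \<in> pair_and_next_two n"
  unfolding pair_and_next_two_def using assms by blast

lemma two_pairsI:
  assumes "{a, b, c, d} \<subseteq> {1..n}" "distinct [a, b, c, d]"
    and "residue b = residue a" "residue c \<noteq> residue a" "residue d = residue c"
  shows "{a, b, c, d} \<in> two_pairs n"
  unfolding two_pairs_def using assms by blast

lemma triple_and_previousI:
  assumes "{a, b, c, d} \<subseteq> {1..n}" "distinct [a, b, c, d]"
    and "residue b = residue a" "residue c = residue a" "residue d = residue (a + 3)"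
  shows "{a, b, c, d} \<in> triple_and_previous n"
  unfolding triple_and_previous_def using assms by blast

lemma quadrupleI:
  assumes "{a, b, c, d} \<subseteq> {1..n}" "distinct [a, b, c, d]"
    and "residue b = residue a" "residue c = residue a" "residue d = residue a"
  shows "{a, b, c, d} \<in> quadruple n"
  unfolding quadruple_def using assms by blast

lemma type_members:
  assumes "F \<in> pair_and_next_two n \<union> two_pairs n \<union> triple_and_previous n \<union> quadruple n"
  shows "F \<subseteq> {1..n} \<and> card F = 4"
  using assms by (auto simp: pair_and_next_two_def two_pairs_def triple_and_previous_def quadruple_def)

text \<open>
  The number of ordered pairs of congruent elements is the sum of the squares of the class sizes. It
  takes the values 6, 8, 10 and 16 on the four types and thus tells them apart.
\<close>

definition congruent_pairs :: "nat set \<Rightarrow> nat" where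
  "congruent_pairs F = (\<Sum>x\<in>F. \<Sum>y\<in>F. if residue x = residue y then 1 else 0)"

lemma congruent_pairs_pair_and_next_two: "F \<in> pair_and_next_two n \<Longrightarrow> congruent_pairs F = 6"
proof -
  assume "F \<in> pair_and_next_two n"
  then obtain a b c d where F: "F = {a, b, c, d}" "distinct [a, b, c, d]"
      "residue b = residue a" "residue c = residue (a + 1)" "residue d = residue (a + 2)"
    unfolding pair_and_next_two_def by blast
  have "residue c \<noteq> residue a" "residue d \<noteq> residue a" "residue d \<noteq> residue c"
    using F(4,5) shifted_residues_distinct by metis+
  then show ?thesis using F(1,2,3) by (simp add: congruent_pairs_def)
qed

lemma congruent_pairs_two_pairs: "F \<in> two_pairs n \<Longrightarrow> congruent_pairs F = 8"
proof -
  assume "F \<in> two_pairs n"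
  then obtain a b c d where F: "F = {a, b, c, d}" "distinct [a, b, c, d]"
      "residue b = residue a" "residue c \<noteq> residue a" "residue d = residue c"
    unfolding two_pairs_def by blast
  then show ?thesis by (simp add: congruent_pairs_def)
qed

lemma congruent_pairs_triple_and_previous: "F \<in> triple_and_previous n \<Longrightarrow> congruent_pairs F = 10"
proof -
  assume "F \<in> triple_and_previous n"
  then obtain a b c d where F: "F = {a, b, c, d}" "distinct [a, b, c, d]"
      "residue b = residue a" "residue c = residue a" "residue d = residue (a + 3)"
    unfolding triple_and_previous_def by blast
  have "residue d \<noteq> residue a" using F(5) shifted_residues_distinct by metis
  then show ?thesis using F(1-4) by (simp add: congruent_pairs_def)
qed

lemma congruent_pairs_quadruple: "F \<in> quadruple n \<Longrightarrow> congruent_pairs F = 16"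
proof -
  assume "F \<in> quadruple n"
  then obtain a b c d where F: "F = {a, b, c, d}" "distinct [a, b, c, d]"
      "residue b = residue a" "residue c = residue a" "residue d = residue a"
    unfolding quadruple_def by blast
  then show ?thesis by (simp add: congruent_pairs_def)
qed

lemma types_disjoint:
  "pair_and_next_two n \<inter> two_pairs n = {}" "(pair_and_next_two n \<union> two_pairs n) \<inter> triple_and_previous n = {}"
  "(pair_and_next_two n \<union> two_pairs n \<union> triple_and_previous n) \<inter> quadruple n = {}"
  by (auto dest!: congruent_pairs_pair_and_next_two congruent_pairs_two_pairs congruent_pairs_triple_and_previous congruent_pairs_quadruple)

definition class_count :: "nat set \<Rightarrow> nat \<Rightarrow> nat" where
  "class_count F r = card {x\<in>F. residue x = residue r}"

lemma class_count_sum: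
  assumes "finite F"
  shows "class_count F i + class_count F (i + 1) + class_count F (i + 2) + class_count F (i + 3) = card F"
proof -
  let ?C = "\<lambda>r. {x\<in>F. residue x = residue r}"
  have cover: "F = ?C i \<union> ?C (i + 1) \<union> ?C (i + 2) \<union> ?C (i + 3)"
    using shifted_residues_cover[of _ i] by blast
  have "card F = card (?C i \<union> ?C (i + 1) \<union> ?C (i + 2) \<union> ?C (i + 3))"
    by (rule arg_cong[OF cover])
  also have "card (?C i \<union> ?C (i + 1) \<union> ?C (i + 2) \<union> ?C (i + 3)) =
      card (?C i) + card (?C (i + 1)) + card (?C (i + 2)) + card (?C (i + 3))"
  proof -
    have "card (?C i \<union> ?C (i + 1)) = card (?C i) + card (?C (i + 1))"
      by (rule card_Un_disjoint) (use assms shifted_residues_distinct[of i] in auto)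
    moreover have "card (?C i \<union> ?C (i + 1) \<union> ?C (i + 2)) = card (?C i \<union> ?C (i + 1)) + card (?C (i + 2))"
      by (rule card_Un_disjoint) (use assms shifted_residues_distinct[of i] in auto)
    moreover have "card (?C i \<union> ?C (i + 1) \<union> ?C (i + 2) \<union> ?C (i + 3)) =
        card (?C i \<union> ?C (i + 1) \<union> ?C (i + 2)) + card (?C (i + 3))"
      by (rule card_Un_disjoint) (use assms shifted_residues_distinct[of i] in auto)
    ultimately show ?thesis by (simp only:)
  qed
  finally show ?thesis unfolding class_count_def by (rule sym)
qed

lemma class_count_ge:
  assumes "m \<le> class_count F r"
  shows "\<exists>xs. length xs = m \<and> distinct xs \<and> set xs \<subseteq> F \<and> (\<forall>x\<in>set xs. residue x = residue r)"
proof -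
  obtain T where T: "T \<subseteq> {x\<in>F. residue x = residue r}" "card T = m" "finite T"
    by (rule obtain_subset_with_card_n[OF assms[unfolded class_count_def]])
  then obtain xs where "set xs = T" "distinct xs" using finite_distinct_list by blast
  then show ?thesis using T distinct_card[of xs] by auto
qed

lemma class_count_ge1:
  assumes "1 \<le> class_count F r"
  obtains x where "x \<in> F" "residue x = residue r"
proof -
  obtain xs where xs: "length xs = 1" "set xs \<subseteq> F" "\<forall>x\<in>set xs. residue x = residue r"
    using class_count_ge[OF assms] by blast
  obtain a where "xs = [a]" using xs(1) by (auto simp: length_Suc_conv)
  then show thesis using that xs by simp
qed

lemma class_count_ge2:
  assumes "2 \<le> class_count F r"
  obtains a b where "{a, b} \<subseteq> F" "distinct [a, b]" "residue a = residue r" "residue b = residue r"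
proof -
  obtain xs where xs: "length xs = 2" "distinct xs" "set xs \<subseteq> F" "\<forall>x\<in>set xs. residue x = residue r"
    using class_count_ge[OF assms] by blast
  obtain a b where "xs = [a, b]" using xs(1) by (auto simp: length_Suc_conv numeral_eq_Suc)
  then show thesis using that[of a b] xs(2-4) by simp
qed

lemma class_count_ge3:
  assumes "3 \<le> class_count F r"
  obtains a b c where "{a, b, c} \<subseteq> F" "distinct [a, b, c]" "residue a = residue r" "residue b = residue r" "residue c = residue r"
proof -
  obtain xs where xs: "length xs = 3" "distinct xs" "set xs \<subseteq> F" "\<forall>x\<in>set xs. residue x = residue r"
    using class_count_ge[OF assms] by blast
  obtain a b c where "xs = [a, b, c]" using xs(1) by (auto simp: length_Suc_conv numeral_eq_Suc)
  then show thesis using that[of a b c] xs(2-4) by simp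
qed

lemma class_count_ge4:
  assumes "4 \<le> class_count F r"
  obtains a b c d where "{a, b, c, d} \<subseteq> F" "distinct [a, b, c, d]" "residue a = residue r" "residue b = residue r" "residue c = residue r" "residue d = residue r"
proof -
  obtain xs where xs: "length xs = 4" "distinct xs" "set xs \<subseteq> F" "\<forall>x\<in>set xs. residue x = residue r"
    using class_count_ge[OF assms] by blast
  obtain a b c d where "xs = [a, b, c, d]" using xs(1) by (auto simp: length_Suc_conv numeral_eq_Suc)
  then show thesis using that[of a b c d] xs(2-4) by simp
qed

text \<open>
  The assumption that no member lies inside \<open>F\<close> bounds the class sizes: \<open>not1\<close>, \<open>not2\<close>,
  \<open>not3\<close> and \<open>not4\<close> exclude one type each. Two elements share a class \<open>i\<close>, and by \<open>not2\<close>
  every other class has at most one element. By \<open>not3\<close> and \<open>not4\<close> the classes \<open>i\<close> and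
  \<open>i + 3\<close> together have at most three elements, so the other two are left to the classes
  \<open>i + 1\<close> and \<open>i + 2\<close>, one to each, against \<open>not1\<close>.
\<close>

lemma five_indices_contain_member:
  assumes F: "F \<subseteq> {1..n}" "card F = 5"
  shows "\<exists>G \<in> pair_and_next_two n \<union> two_pairs n \<union> triple_and_previous n \<union> quadruple n. G \<subseteq> F"
proof (rule ccontr)
  let ?c = "class_count F"
  assume "\<not> ?thesis"
  then have neg: "\<not> G \<subseteq> F" if "G \<in> pair_and_next_two n \<union> two_pairs n \<union> triple_and_previous n \<union> quadruple n" for G
    using that by blast
  have "finite F" using F finite_subset by blast
  note sum = class_count_sum[OF this, unfolded F(2)]
  have not1: "\<not> (2 \<le> ?c i \<and> 1 \<le> ?c (i + 1) \<and> 1 \<le> ?c (i + 2))" for i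
  proof
    assume c: "2 \<le> ?c i \<and> 1 \<le> ?c (i + 1) \<and> 1 \<le> ?c (i + 2)"
    obtain a b where ab: "{a, b} \<subseteq> F" "distinct [a, b]" "residue a = residue i" "residue b = residue i"
      using c class_count_ge2 by blast
    obtain u where u: "u \<in> F" "residue u = residue (i + 1)" using c class_count_ge1 by blast
    obtain v where v: "v \<in> F" "residue v = residue (i + 2)" using c class_count_ge1 by blast
    have res: "residue u = residue (a + 1)" "residue v = residue (a + 2)"
      using u v shifted_residue_cong[OF ab(3)] by (simp_all only:)
    then have "u \<noteq> a" "v \<noteq> a" "u \<noteq> b" "v \<noteq> b" "u \<noteq> v"
      using ab(3,4) u(2) v(2) shifted_residues_distinct[of i] by auto
    then have dist: "distinct [a, b, u, v]" using ab(2) by auto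
    have in_range: "{a, b, u, v} \<subseteq> {1..n}" using ab(1) u(1) v(1) F(1) by blast
    have "{a, b, u, v} \<in> pair_and_next_two n"
      by (rule pair_and_next_twoI[OF in_range dist _ res]) (simp only: ab)
    then show False using neg[of "{a, b, u, v}"] ab(1) u(1) v(1) by simp
  qed
  have not2: "\<not> (2 \<le> ?c i \<and> 2 \<le> ?c j)" if "residue i \<noteq> residue j" for i j
  proof
    assume c: "2 \<le> ?c i \<and> 2 \<le> ?c j"
    obtain a b where ab: "{a, b} \<subseteq> F" "distinct [a, b]" "residue a = residue i" "residue b = residue i"
      using c class_count_ge2 by blast
    obtain u v where uv: "{u, v} \<subseteq> F" "distinct [u, v]" "residue u = residue j" "residue v = residue j"
      using c class_count_ge2 by blast
    have dist: "distinct [a, b, u, v]" using ab uv that by auto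
    have in_range: "{a, b, u, v} \<subseteq> {1..n}" using ab(1) uv(1) F(1) by blast
    have "{a, b, u, v} \<in> two_pairs n"
      by (rule two_pairsI[OF in_range dist]) (use ab uv that in simp_all)
    then show False using neg[of "{a, b, u, v}"] ab(1) uv(1) by simp
  qed
  have not3: "\<not> (3 \<le> ?c i \<and> 1 \<le> ?c (i + 3))" for i
  proof
    assume c: "3 \<le> ?c i \<and> 1 \<le> ?c (i + 3)"
    obtain a b u where abu: "{a, b, u} \<subseteq> F" "distinct [a, b, u]"
        "residue a = residue i" "residue b = residue i" "residue u = residue i"
      using c class_count_ge3 by blast
    obtain v where v: "v \<in> F" "residue v = residue (i + 3)" using c class_count_ge1 by blast
    have res: "residue v = residue (a + 3)" using v shifted_residue_cong[OF abu(3)] by (simp only:)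
    then have "v \<noteq> a" "v \<noteq> b" "v \<noteq> u"
      using abu(3-5) v(2) shifted_residues_distinct[of i] by auto
    then have dist: "distinct [a, b, u, v]" using abu(2) by auto
    have in_range: "{a, b, u, v} \<subseteq> {1..n}" using abu(1) v(1) F(1) by blast
    have "{a, b, u, v} \<in> triple_and_previous n"
      by (rule triple_and_previousI[OF in_range dist _ _ res]) (simp_all only: abu)
    then show False using neg[of "{a, b, u, v}"] abu(1) v(1) by simp
  qed
  have not4: "\<not> 4 \<le> ?c i" for i
  proof
    assume c: "4 \<le> ?c i"
    then obtain a b u v where abuv: "{a, b, u, v} \<subseteq> F" "distinct [a, b, u, v]"
        "residue a = residue i" "residue b = residue i" "residue u = residue i" "residue v = residue i"
      using class_count_ge4 by blast
    have in_range: "{a, b, u, v} \<subseteq> {1..n}" using abuv(1) F(1) by blast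
    have "{a, b, u, v} \<in> quadruple n"
      by (rule quadrupleI[OF in_range abuv(2)]) (simp_all only: abuv)
    then show False using neg[of "{a, b, u, v}"] abuv(1) by simp
  qed
  have "\<exists>i. 2 \<le> ?c i"
  proof (rule ccontr)
    assume "\<not> ?thesis"
    then have "\<not> 2 \<le> ?c i" for i by blast
    then have "?c i \<le> 1" for i by (simp add: not_le less_Suc_eq_le numeral_2_eq_2)
    from this[of 0] this[of 1] this[of 2] this[of 3] sum[of 0] show False
      by (simp add: numeral_2_eq_2 numeral_3_eq_3)
  qed
  then obtain i where i: "2 \<le> ?c i" ..
  have "?c (i + 1) \<le> 1" "?c (i + 2) \<le> 1" "?c (i + 3) \<le> 1"
    using i shifted_residues_distinct(1-3)[of i, symmetric]
      not2[of i "i + 1"] not2[of i "i + 2"] not2[of i "i + 3"] by linarith+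
  moreover have "?c i + ?c (i + 3) \<le> 3"
    by (cases "1 \<le> ?c (i + 3)") (use not3[of i] not4[of i] calculation in linarith)+
  ultimately have "1 \<le> ?c (i + 1)" "1 \<le> ?c (i + 2)"
    using sum[of i] by linarith+
  then show False using i not1[of i] by blast
qed

text \<open>
  Starting from the representative \<open>s\<close> of the class in \<open>{1..4}\<close>, the numbers \<open>s\<close>, \<open>s + 4\<close>,
  \<open>s + 8\<close> and \<open>s + 12\<close> are at most 16, and three elements cannot exhaust them.
\<close>

lemma ex_congruent_index:
  fixes n r :: nat
  assumes "16 \<le> n" "finite F" "card F \<le> 3"
  shows "\<exists>w\<in>{1..n}. residue w = residue r \<and> w \<notin> F"
proof -
  define s where "s = (if r mod 4 = 0 then 4 else r mod 4)"
  define C where "C = (\<lambda>k. s + 4 * k) ` {..<4}"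
  have s: "1 \<le> s" "s \<le> 4" "s mod 4 = r mod 4" by (auto simp: s_def)
  have "card C = 4" by (simp add: C_def card_image inj_on_def)
  then have "\<not> C \<subseteq> F" using card_mono[OF assms(2), of C] assms(3) by linarith
  then obtain w where w: "w \<in> C" "w \<notin> F" by blast
  then obtain k where k: "k < 4" "w = s + 4 * k" by (auto simp: C_def)
  have "residue w = residue r" using k(2) s(3) by (simp add: residue_def)
  moreover have "w \<in> {1..n}" using k s(1,2) assms(1) by simp
  ultimately show ?thesis using w(2) by blast
qed

text \<open>
  If two of the indices are congruent, a new element congruent to the third one yields type
  \<open>2 + 2\<close>, or type \<open>4\<close> if all three are congruent. Otherwise exactly one class \<open>i\<close> is
  missed, and doubling the class \<open>i + 1\<close> yields type \<open>2 + 1 + 1\<close>.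
\<close>

lemma three_indices_in_member:
  assumes n: "16 \<le> n" and F: "F \<subseteq> {1..n}" "card F = 3"
  shows "\<exists>G \<in> pair_and_next_two n \<union> two_pairs n \<union> triple_and_previous n \<union> quadruple n. F \<subseteq> G"
proof -
  have fin: "finite F" using F finite_subset by blast
  have ex: "\<exists>w\<in>{1..n}. residue w = residue r \<and> w \<notin> F" for r
    using ex_congruent_index[OF n fin] F(2) by simp
  show ?thesis
  proof (cases "\<exists>i. 2 \<le> class_count F i")
    case True
    then obtain i x y where xy: "{x, y} \<subseteq> F" "distinct [x, y]" "residue x = residue i" "residue y = residue i"
      using class_count_ge2 by metis
    have "card (F - {x, y}) = 1" using xy F fin by (subst card_Diff_subset) auto
    then obtain z where "F - {x, y} = {z}" by (auto simp: card_1_singleton_iff)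
    then have z: "F = {x, y, z}" "z \<noteq> x" "z \<noteq> y" using xy by auto
    obtain w where w: "w \<in> {1..n}" "residue w = residue z" "w \<notin> F" using ex by blast
    have dist: "distinct [x, y, z, w]" using z w(3) xy(2) by auto
    have in_range: "{x, y, z, w} \<subseteq> {1..n}" using z(1) w(1) F(1) by blast
    have yx: "residue y = residue x" by (simp only: xy)
    have "{x, y, z, w} \<in> two_pairs n \<union> quadruple n"
    proof (cases "residue z = residue x")
      case True
      then show ?thesis using quadrupleI[OF in_range dist yx] w(2) by simp
    next
      case False
      then show ?thesis using two_pairsI[OF in_range dist yx] w(2) by simp
    qed
    moreover have "F \<subseteq> {x, y, z, w}" using z(1) by simp
    ultimately show ?thesis by blast
  next
    case False
    then have "\<not> 2 \<le> class_count F i" for i by blast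
    then have le: "class_count F i \<le> 1" for i by (simp add: not_le less_Suc_eq_le numeral_2_eq_2)
    have "\<exists>i. class_count F i = 0"
    proof (rule ccontr)
      assume "\<not> ?thesis"
      then have "1 \<le> class_count F i" for i by (simp add: Suc_le_eq)
      from this[of 0] this[of 1] this[of 2] this[of 3] class_count_sum[OF fin, of 0] F(2)
      show False by (simp add: numeral_2_eq_2 numeral_3_eq_3)
    qed
    then obtain i where "class_count F i = 0" ..
    then have pos: "1 \<le> class_count F (i + 1)" "1 \<le> class_count F (i + 2)" "1 \<le> class_count F (i + 3)"
      using class_count_sum[OF fin, of i] F(2) le[of "i + 1"] le[of "i + 2"] le[of "i + 3"]
      by linarith+
    obtain a where a: "a \<in> F" "residue a = residue (i + 1)" using class_count_ge1[OF pos(1)] .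
    obtain u where u: "u \<in> F" "residue u = residue (i + 2)" using class_count_ge1[OF pos(2)] .
    obtain v where v: "v \<in> F" "residue v = residue (i + 3)" using class_count_ge1[OF pos(3)] .
    have res: "residue u = residue (a + 1)" "residue v = residue (a + 2)"
      using u(2) v(2) shifted_residue_cong[OF a(2), of 1] shifted_residue_cong[OF a(2), of 2]
      by (simp_all add: numeral_2_eq_2 numeral_3_eq_3)
    have "u \<noteq> a" "v \<noteq> a" "u \<noteq> v" using a(2) u(2) v(2) shifted_residues_distinct[of i] by auto
    then have "card {a, u, v} = card F" using F by simp
    then have Feq: "F = {a, u, v}" using card_subset_eq[OF fin, of "{a, u, v}"] a(1) u(1) v(1) by simp
    obtain w where w: "w \<in> {1..n}" "residue w = residue a" "w \<notin> F" using ex by blast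
    have dist: "distinct [a, w, u, v]" using w Feq \<open>u \<noteq> a\<close> \<open>v \<noteq> a\<close> \<open>u \<noteq> v\<close> by auto
    have in_range: "{a, w, u, v} \<subseteq> {1..n}" using a(1) u(1) v(1) w(1) F(1) by blast
    have "{a, w, u, v} \<in> pair_and_next_two n" by (rule pair_and_next_twoI[OF in_range dist w(2) res])
    moreover have "F \<subseteq> {a, w, u, v}" using Feq by simp
    ultimately show ?thesis by blast
  qed
qed

section \<open>From monomials to index sets\<close>

lemma X_eq_iff: "(X j :: 'k::field mpoly) = X l \<longleftrightarrow> j = l"
  using sqfree_monom_eq_iff[of "{j}" "{l}", where 'k='k] by (simp add: sqfree_monom_def)

lemma sqfree_monom_four:
  "distinct [a, b, c, d] \<Longrightarrow> (sqfree_monom {a, b, c, d} :: 'k::field mpoly) = X a * X b * X c * X d"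
  by (simp add: sqfree_monom_def mult.assoc)

text \<open>
  The classes from which the four variables are taken are listed in \<open>R\<close>, and \<open>P\<close> is the
  condition on the indices that amounts to it. Each prescribed set of generators is an instance; its
  product description and its index family differ only in how the admissible classes are expressed.
\<close>

lemma monomials_by_indices:
  fixes S :: "nat \<Rightarrow> 'k::field mpoly set"
  assumes S: "\<And>i. S i = {X j | j. 1 \<le> j \<and> j \<le> n \<and> residue j = residue i}"
    and PQ: "\<And>a b c d. P a b c d \<longleftrightarrow> (\<exists>(i, j, k, l) \<in> R. residue a = residue i \<and> residue b = residue j \<and> residue c = residue k \<and> residue d = residue l)"
  shows "{t * u * v * w | t u v w. distinct [t, u, v, w] \<and>
      (\<exists>(i, j, k, l) \<in> R. t \<in> S i \<and> u \<in> S j \<and> v \<in> S k \<and> w \<in> S l)} =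
    sqfree_monom ` {{a, b, c, d} | a b c d. {a, b, c, d} \<subseteq> {1..n} \<and> distinct [a, b, c, d] \<and> P a b c d}"
    (is "?L = sqfree_monom ` ?F")
proof (intro equalityI subsetI)
  fix g assume "g \<in> ?L"
  then obtain t u v w i j k l where g: "g = t * u * v * w" "distinct [t, u, v, w]"
      "(i, j, k, l) \<in> R" "t \<in> S i" "u \<in> S j" "v \<in> S k" "w \<in> S l"
    by blast
  have index: "\<exists>a. x = X a \<and> a \<in> {1..n} \<and> residue a = residue r" if "x \<in> S r" for x r
    using that unfolding S by auto
  obtain a where a: "t = X a" "a \<in> {1..n}" "residue a = residue i" using index[OF g(4)] by blast
  obtain b where b: "u = X b" "b \<in> {1..n}" "residue b = residue j" using index[OF g(5)] by blast
  obtain c where c: "v = X c" "c \<in> {1..n}" "residue c = residue k" using index[OF g(6)] by blast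
  obtain d where d: "w = X d" "d \<in> {1..n}" "residue d = residue l" using index[OF g(7)] by blast
  have dist: "distinct [a, b, c, d]" using g(2) unfolding a b c d by auto
  have "P a b c d" unfolding PQ using g(3) a(3) b(3) c(3) d(3) by blast
  moreover have "{a, b, c, d} \<subseteq> {1..n}" using a(2) b(2) c(2) d(2) by simp
  ultimately have "{a, b, c, d} \<in> ?F" using dist by blast
  moreover have "g = sqfree_monom {a, b, c, d}"
    unfolding g(1) a b c d by (rule sqfree_monom_four[OF dist, symmetric])
  ultimately show "g \<in> sqfree_monom ` ?F" by blast
next
  fix g :: "'k mpoly" assume "g \<in> sqfree_monom ` ?F"
  then obtain a b c d where g: "g = sqfree_monom {a, b, c, d}" "{a, b, c, d} \<subseteq> {1..n}"
      "distinct [a, b, c, d]" "P a b c d" by blast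
  then obtain i j k l where "(i, j, k, l) \<in> R"
      "residue a = residue i" "residue b = residue j" "residue c = residue k" "residue d = residue l"
    unfolding PQ by blast
  then have "\<exists>(i, j, k, l) \<in> R. (X a :: 'k mpoly) \<in> S i \<and> (X b :: 'k mpoly) \<in> S j \<and> (X c :: 'k mpoly) \<in> S k \<and> (X d :: 'k mpoly) \<in> S l"
    using g(2) unfolding S by (intro bexI[of _ "(i, j, k, l)"]) auto
  moreover have "distinct [X a :: 'k mpoly, X b, X c, X d]" using g(3) by (simp add: X_eq_iff)
  ultimately show "g \<in> ?L"
    using sqfree_monom_four[OF g(3), where 'k='k] unfolding g(1) by blast
qed

theorem theorem5p5:
  fixes n :: nat
    and S :: "nat \<Rightarrow> 'k::field mpoly set"
    and G1 G2 G3 G4 G5 :: "'k mpoly set"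
  assumes "n \<ge> 16"
    and "even (n choose 4)"
    and "\<And>i. S i = {X j | j. 1 \<le> j \<and> j \<le> n \<and> j mod 4 = i mod 4}"
    and "G1 = {t * u * v * w | t u v w. distinct [t, u, v, w] \<and>
           (\<exists>i \<in> {1..4}. {t, u} \<subseteq> S i \<and> v \<in> S (i + 1) \<and> w \<in> S (i + 2))}"
    and "G2 = {t * u * v * w | t u v w. distinct [t, u, v, w] \<and>
           (\<exists>i j. 1 \<le> i \<and> i < j \<and> j \<le> 4 \<and> {t, u} \<subseteq> S i \<and> {v, w} \<subseteq> S j)}"
    and "G3 = {t * u * v * w | t u v w. distinct [t, u, v, w] \<and>
           (\<exists>i \<in> {1..4}. {t, u, v} \<subseteq> S i \<and> w \<in> S (i - 1))}"
    and "G4 = {t * u * v * w | t u v w. distinct [t, u, v, w] \<and>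
           (\<exists>i \<in> {1..4}. {t, u, v, w} \<subseteq> S i)}"
    and "G5 \<subseteq> {sqfree_monom F | F. F \<subseteq> {1..n} \<and> card F = 4} - (G1 \<union> G2 \<union> G3 \<union> G4)"
    and "int (card G5) =
           int (n choose 4) div 2 - (int (card G1) + int (card G2) + int (card G3) + int (card G4))"
  shows "f_ideal n (Idl\<^bsub>poly_ring n\<^esub> (G1 \<union> G2 \<union> G3 \<union> G4 \<union> G5))"
proof -
  note n = assms(1)
  note S = assms(3)[folded residue_def]
  \<comment> \<open>the representative of class 0 is 4\<close>
  have residue: "\<exists>i\<in>{1..4}. residue a = residue i" for a
    by (rule bexI[of _ "if a mod 4 = 0 then 4 else a mod 4"]) (auto simp: residue_def Suc_le_eq)
  have G1: "G1 = sqfree_monom ` pair_and_next_two n"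
  proof -
    let ?R = "{(i, i, i + 1, i + 2) | i. i \<in> {1..4::nat}}"
    have R: "(\<exists>(i, j, k, l) \<in> ?R. Q i j k l) \<longleftrightarrow> (\<exists>i\<in>{1..4}. Q i i (i + 1) (i + 2))" for Q
      by blast
    have "(residue b = residue a \<and> residue c = residue (a + 1) \<and> residue d = residue (a + 2)) \<longleftrightarrow>
        (\<exists>i\<in>{1..4}. residue a = residue i \<and> residue b = residue i \<and>
          residue c = residue (i + 1) \<and> residue d = residue (i + 2))" for a b c d
      using residue[of a] by (metis shifted_residue_cong)
    from monomials_by_indices[OF S, of _ ?R, unfolded R, OF this]
    show ?thesis unfolding assms(4) pair_and_next_two_def by (simp add: conj_assoc)
  qed
  have G2: "G2 = sqfree_monom ` two_pairs n"
  proof -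
    let ?R = "{(i, i, j, j) | i j. i \<in> {1..4::nat} \<and> j \<in> {1..4::nat} \<and> i \<noteq> j}"
    have R: "(\<exists>(i, i', j, j') \<in> ?R. Q i i' j j') \<longleftrightarrow>
        (\<exists>i\<in>{1..4}. \<exists>j\<in>{1..4}. i \<noteq> j \<and> Q i i j j)" for Q
      by blast
    have "residue i \<noteq> residue j" if "i \<in> {1..4}" "j \<in> {1..4}" "i \<noteq> j" for i j :: nat
      using that by (auto simp: residue_def mod_if split: if_splits)
    then have "(residue b = residue a \<and> residue c \<noteq> residue a \<and> residue d = residue c) \<longleftrightarrow>
        (\<exists>i\<in>{1..4}. \<exists>j\<in>{1..4}. i \<noteq> j \<and> residue a = residue i \<and> residue b = residue i \<and>
          residue c = residue j \<and> residue d = residue j)" for a b c d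
      using residue[of a] residue[of c] by metis
    from monomials_by_indices[OF S, of _ ?R, unfolded R, OF this]
    have "{t * u * v * w | t u v w. distinct [t, u, v, w] \<and>
        (\<exists>i\<in>{1..4}. \<exists>j\<in>{1..4}. i \<noteq> j \<and> t \<in> S i \<and> u \<in> S i \<and> v \<in> S j \<and> w \<in> S j)} = sqfree_monom ` two_pairs n"
      unfolding two_pairs_def by (simp add: conj_assoc)
    \<comment> \<open>exchanging the two pairs does not change the product, so \<open>i \<noteq> j\<close> may replace \<open>i < j\<close>\<close>
    moreover have "{t * u * v * w | t u v w. distinct [t, u, v, w] \<and>
        (\<exists>i\<in>{1..4}. \<exists>j\<in>{1..4}. i \<noteq> j \<and> t \<in> S i \<and> u \<in> S i \<and> v \<in> S j \<and> w \<in> S j)} = G2"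
    proof (intro equalityI subsetI)
      fix g assume "g \<in> {t * u * v * w | t u v w. distinct [t, u, v, w] \<and>
        (\<exists>i\<in>{1..4}. \<exists>j\<in>{1..4}. i \<noteq> j \<and> t \<in> S i \<and> u \<in> S i \<and> v \<in> S j \<and> w \<in> S j)}"
      then obtain t u v w i j where g: "g = t * u * v * w" "distinct [t, u, v, w]"
          "i \<in> {1..4}" "j \<in> {1..4}" "i \<noteq> j" "t \<in> S i" "u \<in> S i" "v \<in> S j" "w \<in> S j" by blast
      show "g \<in> G2"
      proof (cases "i < j")
        case True
        then have "1 \<le> i \<and> i < j \<and> j \<le> 4 \<and> {t, u} \<subseteq> S i \<and> {v, w} \<subseteq> S j" using g by simp
        then show ?thesis
          unfolding assms(5) mem_Collect_eq using g(1,2)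
          by - (rule exI[of _ t], rule exI[of _ u], rule exI[of _ v], rule exI[of _ w], blast)
      next
        case False
        then have "1 \<le> j \<and> j < i \<and> i \<le> 4 \<and> {v, w} \<subseteq> S j \<and> {t, u} \<subseteq> S i" using g by simp
        moreover have "g = v * w * t * u" using g(1) by (simp add: ac_simps)
        moreover have "distinct [v, w, t, u]" using g(2) by auto
        ultimately show ?thesis
          unfolding assms(5) mem_Collect_eq
          by - (rule exI[of _ v], rule exI[of _ w], rule exI[of _ t], rule exI[of _ u], blast)
      qed
    next
      fix g assume "g \<in> G2"
      then obtain t u v w i j where g: "g = t * u * v * w" "distinct [t, u, v, w]"
          "1 \<le> i" "i < j" "j \<le> 4" "{t, u} \<subseteq> S i" "{v, w} \<subseteq> S j"
        unfolding assms(5) mem_Collect_eq by (elim exE conjE) (rule that)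
      then have "i \<in> {1..4}" "j \<in> {1..4}" "i \<noteq> j" "t \<in> S i" "u \<in> S i" "v \<in> S j" "w \<in> S j" by auto
      then show "g \<in> {t * u * v * w | t u v w. distinct [t, u, v, w] \<and>
        (\<exists>i\<in>{1..4}. \<exists>j\<in>{1..4}. i \<noteq> j \<and> t \<in> S i \<and> u \<in> S i \<and> v \<in> S j \<and> w \<in> S j)}"
        unfolding mem_Collect_eq using g(1,2)
        by - (rule exI[of _ t], rule exI[of _ u], rule exI[of _ v], rule exI[of _ w], blast)
    qed
    ultimately show ?thesis by simp
  qed
  have G3: "G3 = sqfree_monom ` triple_and_previous n"
  proof -
    let ?R = "{(i, i, i, i - 1) | i. i \<in> {1..4::nat}}"
    have R: "(\<exists>(i, j, k, l) \<in> ?R. Q i j k l) \<longleftrightarrow> (\<exists>i\<in>{1..4}. Q i i i (i - 1))" for Q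
      by blast
    have "residue (i - 1) = residue (a + 3)" if "i \<in> {1..4}" "residue a = residue i" for a i
    proof -
      obtain k where "i = Suc k" using \<open>i \<in> {1..4}\<close> by (cases i) auto
      then show ?thesis
        using shifted_residue_cong[OF that(2), of 3] by (simp add: residue_def)
    qed
    then have "(residue b = residue a \<and> residue c = residue a \<and> residue d = residue (a + 3)) \<longleftrightarrow>
        (\<exists>i\<in>{1..4}. residue a = residue i \<and> residue b = residue i \<and>
          residue c = residue i \<and> residue d = residue (i - 1))" for a b c d
      using residue[of a] by metis
    from monomials_by_indices[OF S, of _ ?R, unfolded R, OF this]
    show ?thesis unfolding assms(6) triple_and_previous_def by (simp add: conj_assoc)
  qed
  have G4: "G4 = sqfree_monom ` quadruple n"
  proof -
    let ?R = "{(i, i, i, i) | i. i \<in> {1..4::nat}}"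
    have R: "(\<exists>(i, j, k, l) \<in> ?R. Q i j k l) \<longleftrightarrow> (\<exists>i\<in>{1..4}. Q i i i i)" for Q
      by blast
    have "(residue b = residue a \<and> residue c = residue a \<and> residue d = residue a) \<longleftrightarrow>
        (\<exists>i\<in>{1..4}. residue a = residue i \<and> residue b = residue i \<and>
          residue c = residue i \<and> residue d = residue i)" for a b c d
      using residue[of a] by metis
    from monomials_by_indices[OF S, of _ ?R, unfolded R, OF this]
    show ?thesis unfolding assms(7) quadruple_def by (simp add: conj_assoc)
  qed
  let ?types = "pair_and_next_two n \<union> two_pairs n \<union> triple_and_previous n \<union> quadruple n"
  define further where "further = {F. F \<subseteq> {1..n} \<and> card F = 4 \<and> (sqfree_monom F :: 'k mpoly) \<in> G5}"
  have G5: "G5 = sqfree_monom ` further"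
    using assms(8) unfolding further_def by blast
  have new: "further \<inter> ?types = {}"
    using assms(8) unfolding further_def G1 G2 G3 G4 by blast
  let ?\<F> = "?types \<union> further"
  have sub: "F \<subseteq> {1..n} \<and> card F = 4" if "F \<in> ?\<F>" for F
    using that type_members[of F n] by (auto simp: further_def)
  have "?\<F> \<subseteq> Pow {1..n}" using sub by blast
  then have fin: "finite (pair_and_next_two n)" "finite (two_pairs n)" "finite (triple_and_previous n)" "finite (quadruple n)" "finite further"
    by (meson finite_Pow_iff finite_atLeastAtMost finite_subset le_sup_iff)+
  have card: "card (sqfree_monom ` \<G> :: 'k mpoly set) = card \<G>" if "\<G> \<subseteq> ?\<F>" for \<G>
  proof (rule card_image, rule inj_onI)
    fix F G assume FG: "F \<in> \<G>" "G \<in> \<G>" "(sqfree_monom F :: 'k mpoly) = sqfree_monom G"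
    then have "finite F" "finite G" using that sub by (meson finite_atLeastAtMost finite_subset subsetD)+
    then show "F = G" using FG(3) by (simp add: sqfree_monom_eq_iff)
  qed
  have "card ?\<F> = card (pair_and_next_two n) + card (two_pairs n) + card (triple_and_previous n) + card (quadruple n) + card further"
    using fin types_disjoint[of n] new by (simp add: card_Un_disjoint Int_commute)
  moreover have "card G1 = card (pair_and_next_two n)" "card G2 = card (two_pairs n)" "card G3 = card (triple_and_previous n)"
      "card G4 = card (quadruple n)" "card G5 = card further"
    unfolding G1 G2 G3 G4 G5 by (rule card; blast)+
  ultimately have "int (card ?\<F>) = int (n choose 4) div 2" using assms(9) by linarith
  then have half: "2 * card ?\<F> = n choose 4" using assms(2) by presburger
  have "f_ideal n (Idl\<^bsub>poly_ring n\<^esub> (sqfree_monom ` ?\<F>) :: 'k mpoly set)"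
  proof (rule f_ideal_uniform[where d = 4])
    fix F assume F: "F \<subseteq> {1..n}"
    {
      assume "card F = 4 - 1"
      then have "\<exists>G\<in>?types. F \<subseteq> G" using three_indices_in_member[OF n F] by simp
      then show "\<exists>G\<in>?\<F>. F \<subseteq> G" by (elim bexE) (rule bexI, assumption, rule UnI1, assumption)
    next
      assume "card F = 4 + 1"
      then have "\<exists>G\<in>?types. G \<subseteq> F" using five_indices_contain_member[OF F] by simp
      then show "\<exists>G\<in>?\<F>. G \<subseteq> F" by (elim bexE) (rule bexI, assumption, rule UnI1, assumption)
    }
  qed (use n sub half in auto)
  then show ?thesis unfolding G1 G2 G3 G4 G5 by (simp only: image_Un)
qed

end
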